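(* If $R$ is a quasiorder on a non-empty set $U$, then $\mathcal{RS}$ is a complete sublattice of $\wp(U)\times\wp(U)$.
   Context: A quasiorder is a reflexive and transitive binary relation. For a binary relation $R$ on a set $U$ and $x\in U$, $R(x)=\{y\in U\mid x\,R\,y\}$. For $X\subseteq U$, $X^{\blacktriangledown}=\{x\in U\mid R(x)\subseteq X\}$ is the lower approximation and $X^{\blacktriangle}=\{x\in U\mid R(x)\cap X\neq\emptyset\}$ is the upper approximation of $X$. The rough set of $X$ is the pair $\mathcal{A}(X)=(X^{\blacktriangledown},X^{\blacktriangle})$, and $RS=\{\mathcal{A}(X)\mid X\subseteq U\}$. $\mathcal{RS}=(RS,\leq)$ where $\leq$ is the coordinatewise inclusion order: $(X^{\blacktriangledown},X^{\blacktriangle})\leq(Y^{\blacktriangledown},Y^{\blacktriangle})$ iff $X^{\blacktriangledown}\subseteq Y^{\blacktriangledown}$ and $X^{\blacktriangle}\subseteq Y^{\blacktriangle}$. $\wp(U)$ is the power set of $U$ ordered by inclusion, and $\wp(U)\times\wp(U)$ is ordered coordinatewise, so that arbitrary joins and meets are coordinatewise unions and intersections. A complete sublattice of a complete lattice is a subset closed under arbitrary joins and meets taken in that lattice, with the inherited order. *)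

theory Defs
  imports "HOL-Algebra.Complete_Lattice"
begin

definition nbhd :: "'a set \<Rightarrow> 'a rel \<Rightarrow> 'a \<Rightarrow> 'a set"
  where "nbhd U R x = {y \<in> U. (x, y) \<in> R}"

definition lower_approx :: "'a set \<Rightarrow> 'a rel \<Rightarrow> 'a set \<Rightarrow> 'a set"
  where "lower_approx U R X = {x \<in> U. nbhd U R x \<subseteq> X}"

definition upper_approx :: "'a set \<Rightarrow> 'a rel \<Rightarrow> 'a set \<Rightarrow> 'a set"
  where "upper_approx U R X = {x \<in> U. nbhd U R x \<inter> X \<noteq> {}}"

definition rough_set :: "'a set \<Rightarrow> 'a rel \<Rightarrow> 'a set \<Rightarrow> 'a set \<times> 'a set"
  where "rough_set U R X = (lower_approx U R X, upper_approx U R X)"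

definition RS :: "'a set \<Rightarrow> 'a rel \<Rightarrow> ('a set \<times> 'a set) set"
  where "RS U R = rough_set U R ` Pow U"

(* The product type carries no order in HOL-Algebra, so the coordinatewise order is spelled out. *)
definition coord_le :: "'a set \<times> 'a set \<Rightarrow> 'a set \<times> 'a set \<Rightarrow> bool"
  where "coord_le p q \<longleftrightarrow> fst p \<subseteq> fst q \<and> snd p \<subseteq> snd q"

definition RS_order :: "'a set \<Rightarrow> 'a rel \<Rightarrow> ('a set \<times> 'a set) gorder"
  where "RS_order U R = \<lparr>carrier = RS U R, eq = (=), le = coord_le\<rparr>"

definition Pow_prod :: "'a set \<Rightarrow> ('a set \<times> 'a set) gorder"
  where "Pow_prod U = \<lparr>carrier = Pow U \<times> Pow U, eq = (=), le = coord_le\<rparr>"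

(* Joins and meets are taken in L. The family A may be empty, so a complete sublattice
   contains the least and the greatest element of L. *)
definition complete_sublattice :: "'b gorder \<Rightarrow> 'b gorder \<Rightarrow> bool"
  where "complete_sublattice M L \<longleftrightarrow>
    complete_lattice L \<and>
    carrier M \<subseteq> carrier L \<and>
    (\<forall>x \<in> carrier M. \<forall>y \<in> carrier M. x .=\<^bsub>M\<^esub> y \<longleftrightarrow> x .=\<^bsub>L\<^esub> y) \<and>
    (\<forall>x \<in> carrier M. \<forall>y \<in> carrier M. x \<sqsubseteq>\<^bsub>M\<^esub> y \<longleftrightarrow> x \<sqsubseteq>\<^bsub>L\<^esub> y) \<and>
    (\<forall>A. A \<subseteq> carrier M \<longrightarrow> \<Squnion>\<^bsub>L\<^esub>A \<in> carrier M \<and> \<Sqinter>\<^bsub>L\<^esub>A \<in> carrier M)"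

lemma Pow_prod_simps [simp]:
  "carrier (Pow_prod U) = Pow U \<times> Pow U"
  "x .=\<^bsub>Pow_prod U\<^esub> y \<longleftrightarrow> x = y"
  "x \<sqsubseteq>\<^bsub>Pow_prod U\<^esub> y \<longleftrightarrow> coord_le x y"
  by (simp_all add: Pow_prod_def)

lemma partial_order_Pow_prod: "partial_order (Pow_prod U)"
  by standard (auto simp: Pow_prod_def coord_le_def prod_eq_iff)

lemma least_Upper_Pow_prod:
  assumes "A \<subseteq> Pow U \<times> Pow U"
  shows "least (Pow_prod U) (\<Union>(fst ` A), \<Union>(snd ` A)) (Upper (Pow_prod U) A)"
  using assms by (fastforce simp: least_def Upper_def coord_le_def)

lemma greatest_Lower_Pow_prod:
  assumes "A \<subseteq> Pow U \<times> Pow U"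
  shows "greatest (Pow_prod U) (U \<inter> \<Inter>(fst ` A), U \<inter> \<Inter>(snd ` A)) (Lower (Pow_prod U) A)"
  using assms by (fastforce simp: greatest_def Lower_def coord_le_def)

lemma complete_lattice_Pow_prod: "complete_lattice (Pow_prod U)"
proof (rule partial_order.complete_latticeI[OF partial_order_Pow_prod])
  fix A assume "A \<subseteq> carrier (Pow_prod U)"
  then have "A \<subseteq> Pow U \<times> Pow U" by simp
  from least_Upper_Pow_prod[OF this] greatest_Lower_Pow_prod[OF this]
  show "\<exists>s. least (Pow_prod U) s (Upper (Pow_prod U) A)"
    and "\<exists>i. greatest (Pow_prod U) i (Lower (Pow_prod U) A)" by blast+
qed

lemma sup_Pow_prod:
  assumes "A \<subseteq> Pow U \<times> Pow U"
  shows "\<Squnion>\<^bsub>Pow_prod U\<^esub>A = (\<Union>(fst ` A), \<Union>(snd ` A))"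
  unfolding sup_def
  by (rule some_equality, rule least_Upper_Pow_prod[OF assms],
    erule partial_order.least_unique[OF partial_order_Pow_prod _ least_Upper_Pow_prod[OF assms]])

(* Intersecting with U matters only for empty A, where the meet is (U, U). *)
lemma inf_Pow_prod:
  assumes "A \<subseteq> Pow U \<times> Pow U"
  shows "\<Sqinter>\<^bsub>Pow_prod U\<^esub>A = (U \<inter> \<Inter>(fst ` A), U \<inter> \<Inter>(snd ` A))"
  unfolding inf_def
  by (rule some_equality, rule greatest_Lower_Pow_prod[OF assms],
    erule partial_order.greatest_unique[OF partial_order_Pow_prod _ greatest_Lower_Pow_prod[OF assms]])

end

theory Submission
  imports Defs
begin

text \<open>
  Whether a pair of sets is a rough set can be tested point by point. Write \<open>\<up>x\<close> for the
  neighbourhood of \<open>x\<close>, thought of as the points above \<open>x\<close>. For a quasiorder, a pair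
  \<open>(A, B)\<close> is a rough set iff \<open>A\<close> is an up-set, \<open>B\<close> is a down-set, \<open>A \<subseteq> B\<close>, and no
  \<open>x \<in> B - A\<close> has \<open>\<up>x = {x}\<close> (lemma \<open>RS_iff_rough_pair\<close>). The last condition is forced because
  a set either contains the singleton \<open>{x}\<close> or misses it, so such an \<open>x\<close> is never in the
  boundary \<open>B - A\<close>. All four conditions survive arbitrary coordinatewise unions and intersections, and
  that is the theorem.

  The work lies in producing a set \<open>X\<close> from a pair \<open>(A, B)\<close> that meets the conditions. It must
  satisfy \<open>A \<subseteq> X \<subseteq> B\<close>, and above every boundary point there must be both a point of
  \<open>X\<close> and a point outside \<open>X\<close>. Above some boundary points lies a \<^emph>\<open>leaf\<close>, a boundary point with no
  other boundary point above it. A leaf has another point above it, which is in \<open>A\<close> or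
  outside \<open>B\<close>; the leaf itself is put on the opposite side, so that both kinds of points occur
  above it. Every remaining boundary point has at least two remaining boundary points above it,
  and then a two-colouring in which both colours are cofinal exists (lemma
  \<open>ex_cofinal_splitting\<close>, by Zorn's lemma).
\<close>

section \<open>Splitting a quasiorder into two cofinal parts\<close>

text \<open>
  A set of pairs \<open>(x, b)\<close> is read as a partial colouring of \<open>T\<close> by two colours. The last
  condition makes any point below a coloured point lie below points of both colours. It only
  concerns coloured points, so the empty colouring has it and colourings of regions that do not
  meet can be combined freely; cofinality in all of \<open>T\<close> then comes from maximality.
\<close>

definition alternating_colouring :: "'a set \<Rightarrow> 'a rel \<Rightarrow> ('a \<times> bool) set \<Rightarrow> bool"
  where "alternating_colouring T R P \<longleftrightarrow>
    P \<subseteq> T \<times> UNIV \<and> single_valued P \<and>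
    (\<forall>(x, b) \<in> P. \<exists>y. (x, y) \<in> R \<and> (y, \<not> b) \<in> P)"

lemma alternating_colouring_Union_chain:
  assumes chain: "C \<in> chains {P. alternating_colouring T R P}"
  shows "alternating_colouring T R (\<Union>C)"
proof -
  have good: "alternating_colouring T R P" if "P \<in> C" for P
    using chain that by (auto simp: chains_def)
  have "single_valued (\<Union>C)"
  proof (rule single_valuedI)
    fix x b c assume "(x, b) \<in> \<Union>C" "(x, c) \<in> \<Union>C"
    then obtain P Q where "P \<in> C" "Q \<in> C" "(x, b) \<in> P" "(x, c) \<in> Q" by auto
    moreover from this have "P \<subseteq> Q \<or> Q \<subseteq> P"
      using chain by (auto simp: chains_def chain_subset_def)
    ultimately obtain D where "D \<in> C" "(x, b) \<in> D" "(x, c) \<in> D" by blast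
    then show "b = c"
      using good[of D] by (auto simp: alternating_colouring_def dest: single_valuedD)
  qed
  moreover have "\<Union>C \<subseteq> T \<times> UNIV"
    using good by (auto simp: alternating_colouring_def)
  moreover have "\<exists>y. (x, y) \<in> R \<and> (y, \<not> b) \<in> \<Union>C" if "(x, b) \<in> \<Union>C" for x b
    using that good unfolding alternating_colouring_def by fast
  ultimately show ?thesis
    unfolding alternating_colouring_def by blast
qed

text \<open>
  If some \<open>m\<close> above \<open>x\<close> is maximal up to equivalence, then \<open>m\<close> and another point above it are
  equivalent, and these two get different colours. Otherwise a strictly ascending sequence starts
  at \<open>x\<close>, and its members are coloured alternately.
\<close>

lemma ex_alternating_colouring_above:
  assumes trans: "trans R"
    and refl: "\<And>x. x \<in> T \<Longrightarrow> (x, x) \<in> R"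
    and other: "\<And>x. x \<in> T \<Longrightarrow> \<exists>y\<in>T. (x, y) \<in> R \<and> y \<noteq> x"
    and x: "x \<in> T"
  obtains P where "alternating_colouring T R P" "P \<noteq> {}" "\<And>y b. (y, b) \<in> P \<Longrightarrow> (x, y) \<in> R"
proof (cases "\<exists>m\<in>T. (x, m) \<in> R \<and> (\<forall>y\<in>T. (m, y) \<in> R \<longrightarrow> (y, m) \<in> R)")
  case True
  then obtain m where m: "m \<in> T" "(x, m) \<in> R" "\<forall>y\<in>T. (m, y) \<in> R \<longrightarrow> (y, m) \<in> R" by blast
  obtain n where n: "n \<in> T" "(m, n) \<in> R" "n \<noteq> m" using other[OF m(1)] by blast
  have "(n, m) \<in> R" "(x, n) \<in> R" using m n transD[OF trans] by blast+
  with m n show ?thesis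
    by (intro that[of "{(m, True), (n, False)}"])
      (auto simp: alternating_colouring_def single_valued_def)
next
  case False
  define above where "above = (\<lambda>y. SOME z. z \<in> T \<and> (y, z) \<in> R \<and> (z, y) \<notin> R)"
  have above: "above y \<in> T \<and> (y, above y) \<in> R \<and> (above y, y) \<notin> R" if "y \<in> T" "(x, y) \<in> R" for y
    unfolding above_def by (rule someI_ex) (use False that in blast)
  define s where "s = (\<lambda>n. (above ^^ n) x)"
  have s_above: "s n \<in> T \<and> (x, s n) \<in> R" for n
  proof (induction n)
    case 0
    then show ?case using x refl by (simp add: s_def)
  next
    case (Suc n)
    then show ?case using above[of "s n"] transD[OF trans] by (auto simp: s_def)
  qed
  have s_Suc: "(s n, s (Suc n)) \<in> R" "(s (Suc n), s n) \<notin> R" for n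
    using above[of "s n"] s_above[of n] by (auto simp: s_def)
  have s_mono: "(s m, s (m + k)) \<in> R" for m k
  proof (induction k)
    case 0
    then show ?case using s_above refl by simp
  next
    case (Suc k)
    then show ?case using s_Suc(1) transD[OF trans] by fastforce
  qed
  have s_less: "s m \<noteq> s n" if "m < n" for m n
  proof
    assume "s m = s n"
    moreover have "(s (Suc m), s n) \<in> R"
      using s_mono[of "Suc m" "n - Suc m"] that by simp
    ultimately show False using s_Suc(2)[of m] by simp
  qed
  have s_inj: "s m = s n \<Longrightarrow> m = n" for m n
    using s_less by (metis linorder_neqE_nat)
  define P where "P = range (\<lambda>n. (s n, even n))"
  have "single_valued P"
    by (rule single_valuedI) (auto simp: P_def dest: s_inj)
  moreover have "\<exists>z. (y, z) \<in> R \<and> (z, \<not> b) \<in> P" if yb: "(y, b) \<in> P" for y b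
  proof -
    from yb obtain n where n: "y = s n" "b = even n" by (auto simp: P_def)
    have "(s (Suc n), even (Suc n)) \<in> P" unfolding P_def by blast
    then show ?thesis using n s_Suc(1) by auto
  qed
  ultimately have "alternating_colouring T R P"
    using s_above by (auto simp: alternating_colouring_def P_def)
  moreover have "P \<noteq> {}" "\<And>y b. (y, b) \<in> P \<Longrightarrow> (x, y) \<in> R"
    using s_above by (auto simp: P_def)
  ultimately show ?thesis by (rule that)
qed

text \<open>
  A maximal alternating colouring has coloured points above every \<open>x\<close>: otherwise a
  colouring of points above \<open>x\<close> could be added to it. Hence both of its colours are cofinal, and
  uncoloured points may go to either part.
\<close>

lemma ex_cofinal_splitting:
  assumes trans: "trans R"
    and refl: "\<And>x. x \<in> T \<Longrightarrow> (x, x) \<in> R"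
    and other: "\<And>x. x \<in> T \<Longrightarrow> \<exists>y\<in>T. (x, y) \<in> R \<and> y \<noteq> x"
  obtains Z where "Z \<subseteq> T"
    "\<And>x. x \<in> T \<Longrightarrow> \<exists>y\<in>Z. (x, y) \<in> R" "\<And>x. x \<in> T \<Longrightarrow> \<exists>y\<in>T - Z. (x, y) \<in> R"
proof -
  have "\<exists>P\<in>{P. alternating_colouring T R P}. \<forall>Q\<in>{P. alternating_colouring T R P}. P \<subseteq> Q \<longrightarrow> Q = P"
    by (rule Zorn_Lemma) (use alternating_colouring_Union_chain in blast)
  then obtain P where P: "alternating_colouring T R P"
    and max: "\<And>Q. alternating_colouring T R Q \<Longrightarrow> P \<subseteq> Q \<Longrightarrow> Q = P" by auto
  have coloured: "\<exists>y b. (x, y) \<in> R \<and> (y, b) \<in> P" if x: "x \<in> T" for x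
  proof (rule ccontr)
    assume none: "\<not> ?thesis"
    obtain Q where Q: "alternating_colouring T R Q" "Q \<noteq> {}"
      and above: "\<And>y b. (y, b) \<in> Q \<Longrightarrow> (x, y) \<in> R"
      using ex_alternating_colouring_above[OF trans refl other x] by metis
    have "single_valued (P \<union> Q)"
      using P Q none above unfolding alternating_colouring_def single_valued_def by blast
    then have "alternating_colouring T R (P \<union> Q)"
      using P Q(1) unfolding alternating_colouring_def by fast
    then have "P \<union> Q = P" by (rule max) simp
    with Q(2) above none show False by (metis UnCI ex_in_conv surj_pair)
  qed
  have both: "\<exists>y. (x, y) \<in> R \<and> (y, b) \<in> P" if x: "x \<in> T" for x b
  proof -
    obtain y c where y: "(x, y) \<in> R" "(y, c) \<in> P" using coloured[OF x] by blast
    then obtain z where "(y, z) \<in> R" "(z, \<not> c) \<in> P"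
      using P unfolding alternating_colouring_def by blast
    with y show ?thesis using transD[OF trans] by (cases "b = c") auto
  qed
  show ?thesis
  proof (rule that[of "{y. (y, True) \<in> P}"])
    show "{y. (y, True) \<in> P} \<subseteq> T"
      using P by (auto simp: alternating_colouring_def)
    show "\<exists>y\<in>{y. (y, True) \<in> P}. (x, y) \<in> R" if "x \<in> T" for x
      using both[OF that, of True] by blast
    show "\<exists>y\<in>T - {y. (y, True) \<in> P}. (x, y) \<in> R" if x: "x \<in> T" for x
    proof -
      obtain y where "(x, y) \<in> R" "(y, False) \<in> P" using both[OF x] by blast
      moreover from this have "y \<in> T" "(y, True) \<notin> P"
        using P by (auto simp: alternating_colouring_def dest: single_valuedD)
      ultimately show ?thesis by blast
    qed
  qed
qed

section \<open>Rough sets of a quasiorder\<close>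

definition rough_pair :: "'a set \<Rightarrow> 'a rel \<Rightarrow> 'a set \<times> 'a set \<Rightarrow> bool"
  where "rough_pair U R p \<longleftrightarrow>
    fst p \<subseteq> snd p \<and> snd p \<subseteq> U \<and>
    (\<forall>x\<in>fst p. nbhd U R x \<subseteq> fst p) \<and>
    (\<forall>x\<in>U. nbhd U R x \<inter> snd p \<noteq> {} \<longrightarrow> x \<in> snd p) \<and>
    (\<forall>x\<in>snd p - fst p. nbhd U R x \<noteq> {x})"

lemma rough_pair_rough_set:
  assumes "preorder_on U R"
  shows "rough_pair U R (rough_set U R X)"
proof -
  have refl: "\<And>x. x \<in> U \<Longrightarrow> (x, x) \<in> R" and trans: "trans R"
    using assms by (auto simp: preorder_on_def refl_on_def)
  have sub: "lower_approx U R X \<subseteq> upper_approx U R X"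
    using refl by (fastforce simp: lower_approx_def upper_approx_def nbhd_def)
  have up: "nbhd U R x \<subseteq> lower_approx U R X" if "x \<in> lower_approx U R X" for x
    using that by (auto simp: lower_approx_def nbhd_def dest: transD[OF trans])
  have down: "x \<in> upper_approx U R X" if "x \<in> U" "nbhd U R x \<inter> upper_approx U R X \<noteq> {}" for x
    using that by (auto simp: upper_approx_def nbhd_def dest: transD[OF trans])
  have "nbhd U R x \<noteq> {x}" if "x \<in> upper_approx U R X - lower_approx U R X" for x
    using that by (auto simp: upper_approx_def lower_approx_def)
  then show ?thesis
    using sub up down by (simp add: rough_pair_def rough_set_def) (simp add: upper_approx_def)
qed

lemma ex_rough_set_of_rough_pair:
  assumes pre: "preorder_on U R" and pair: "rough_pair U R (A, B)"
  obtains X where "X \<subseteq> U" "rough_set U R X = (A, B)"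
proof -
  have refl: "\<And>x. x \<in> U \<Longrightarrow> (x, x) \<in> R" and trans: "trans R"
    using pre by (auto simp: preorder_on_def refl_on_def)
  have AB: "A \<subseteq> B" and BU: "B \<subseteq> U"
    and up: "\<And>x y. x \<in> A \<Longrightarrow> y \<in> U \<Longrightarrow> (x, y) \<in> R \<Longrightarrow> y \<in> A"
    and down: "\<And>x y. x \<in> U \<Longrightarrow> y \<in> B \<Longrightarrow> (x, y) \<in> R \<Longrightarrow> x \<in> B"
    using pair by (force simp: rough_pair_def nbhd_def)+
  have other: "\<exists>y\<in>U. (x, y) \<in> R \<and> y \<noteq> x" if "x \<in> B - A" for x
  proof -
    have "nbhd U R x \<noteq> {x}" "x \<in> nbhd U R x"
      using pair that refl BU by (auto simp: rough_pair_def nbhd_def)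
    then show ?thesis by (auto simp: nbhd_def)
  qed
  define leaf where "leaf = {x \<in> B - A. \<forall>y\<in>B - A. (x, y) \<in> R \<longrightarrow> y = x}"
  define T where "T = {x \<in> B - A. \<forall>y\<in>leaf. (x, y) \<notin> R}"
  have T_refl: "(x, x) \<in> R" if "x \<in> T" for x
    using that refl BU by (auto simp: T_def)
  have T_other: "\<exists>y\<in>T. (x, y) \<in> R \<and> y \<noteq> x" if x: "x \<in> T" for x
  proof -
    have "x \<notin> leaf" using x T_refl by (auto simp: T_def)
    then obtain y where y: "y \<in> B - A" "(x, y) \<in> R" "y \<noteq> x"
      using x by (auto simp: leaf_def T_def)
    then have "y \<in> T" using x transD[OF trans] by (auto simp: T_def)
    with y show ?thesis by blast
  qed
  obtain Z where Z: "Z \<subseteq> T" "\<And>x. x \<in> T \<Longrightarrow> \<exists>y\<in>Z. (x, y) \<in> R"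
    "\<And>x. x \<in> T \<Longrightarrow> \<exists>y\<in>T - Z. (x, y) \<in> R"
    using ex_cofinal_splitting[OF trans T_refl T_other] by metis
  \<comment> \<open>A leaf below \<open>A\<close> already sees a point of \<open>X\<close> and stays outside \<open>X\<close>; any other leaf goes into
    \<open>X\<close>, because it sees a point outside \<open>B\<close>.\<close>
  define X where "X = A \<union> Z \<union> {x \<in> leaf. \<forall>y\<in>A. (x, y) \<notin> R}"
  have T_leaf: "T \<inter> leaf = {}"
    using T_refl by (auto simp: T_def)
  have AX: "A \<subseteq> X" and XB: "X \<subseteq> B"
    using AB Z(1) by (auto simp: X_def T_def leaf_def)
  have split: "(\<exists>y\<in>X. (x, y) \<in> R) \<and> (\<exists>y\<in>U - X. (x, y) \<in> R)" if x: "x \<in> B - A" for x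
  proof (cases "x \<in> T")
    case True
    have "T - Z \<subseteq> U - X"
      using T_leaf BU by (auto simp: X_def T_def)
    with Z(2,3)[OF True] show ?thesis by (auto simp: X_def)
  next
    case False
    then obtain l where l: "l \<in> leaf" "(x, l) \<in> R" using x by (auto simp: T_def)
    then have l_boundary: "l \<in> B - A" by (auto simp: leaf_def)
    show ?thesis
    proof (cases "\<exists>y\<in>A. (l, y) \<in> R")
      case True
      then obtain y where "y \<in> A" "(x, y) \<in> R" using l transD[OF trans] by blast
      moreover have "l \<in> U - X"
        using True l l_boundary T_leaf Z(1) BU by (auto simp: X_def)
      ultimately show ?thesis using l AX by blast
    next
      case False
      obtain y where y: "y \<in> U" "(l, y) \<in> R" "y \<noteq> l" using other[OF l_boundary] by blast
      have "y \<notin> B" using y l False by (auto simp: leaf_def)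
      moreover have "(x, y) \<in> R" using l y transD[OF trans] by blast
      moreover have "l \<in> X" using l False by (auto simp: X_def)
      ultimately show ?thesis using l y XB by blast
    qed
  qed
  have "lower_approx U R X = A"
  proof
    show "A \<subseteq> lower_approx U R X"
      using AB BU AX up by (auto simp: lower_approx_def nbhd_def)
    show "lower_approx U R X \<subseteq> A"
    proof
      fix x assume "x \<in> lower_approx U R X"
      then have "x \<in> U" "\<And>y. y \<in> U \<Longrightarrow> (x, y) \<in> R \<Longrightarrow> y \<in> X"
        by (auto simp: lower_approx_def nbhd_def)
      then show "x \<in> A" using refl XB split[of x] by blast
    qed
  qed
  moreover have "upper_approx U R X = B"
  proof
    show "upper_approx U R X \<subseteq> B"
      using XB down by (auto simp: upper_approx_def nbhd_def)
    show "B \<subseteq> upper_approx U R X"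
    proof
      fix x assume x: "x \<in> B"
      have "\<exists>y\<in>X. (x, y) \<in> R"
        using x split[of x] AX refl BU by (cases "x \<in> A") auto
      then show "x \<in> upper_approx U R X"
        using x XB BU by (auto simp: upper_approx_def nbhd_def)
    qed
  qed
  ultimately show ?thesis
    using that[of X] XB BU by (auto simp: rough_set_def)
qed

lemma RS_iff_rough_pair:
  assumes "preorder_on U R"
  shows "p \<in> RS U R \<longleftrightarrow> rough_pair U R p"
proof
  assume "p \<in> RS U R"
  then show "rough_pair U R p"
    using rough_pair_rough_set[OF assms] by (auto simp: RS_def)
next
  assume "rough_pair U R p"
  then obtain X where "X \<subseteq> U" "rough_set U R X = p"
    using ex_rough_set_of_rough_pair[OF assms, of "fst p" "snd p"] by auto
  then show "p \<in> RS U R" by (auto simp: RS_def)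
qed

lemma rough_pair_Union:
  assumes pair: "\<And>p. p \<in> F \<Longrightarrow> rough_pair U R p"
  shows "rough_pair U R (\<Union>(fst ` F), \<Union>(snd ` F))"
proof -
  have sub: "fst p \<subseteq> snd p" "snd p \<subseteq> U" if "p \<in> F" for p
    using pair[OF that] by (auto simp: rough_pair_def)
  have up: "nbhd U R x \<subseteq> fst p" if "p \<in> F" "x \<in> fst p" for p x
    using pair[OF that(1)] that(2) by (auto simp: rough_pair_def)
  have down: "x \<in> snd p" if "p \<in> F" "x \<in> U" "nbhd U R x \<inter> snd p \<noteq> {}" for p x
    using pair[OF that(1)] that(2,3) by (auto simp: rough_pair_def)
  have isolated: "nbhd U R x \<noteq> {x}" if "p \<in> F" "x \<in> snd p" "x \<notin> fst p" for p x
    using pair[OF that(1)] that(2,3) by (auto simp: rough_pair_def)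
  show ?thesis
    unfolding rough_pair_def fst_conv snd_conv
  proof (intro conjI ballI impI)
    show "\<Union>(fst ` F) \<subseteq> \<Union>(snd ` F)" "\<Union>(snd ` F) \<subseteq> U"
      using sub by blast+
    show "nbhd U R x \<subseteq> \<Union>(fst ` F)" if "x \<in> \<Union>(fst ` F)" for x
      using that up by blast
    show "x \<in> \<Union>(snd ` F)" if "x \<in> U" "nbhd U R x \<inter> \<Union>(snd ` F) \<noteq> {}" for x
      using that down by blast
    show "nbhd U R x \<noteq> {x}" if "x \<in> \<Union>(snd ` F) - \<Union>(fst ` F)" for x
      using that isolated by blast
  qed
qed

lemma rough_pair_Inter:
  assumes pair: "\<And>p. p \<in> F \<Longrightarrow> rough_pair U R p"
  shows "rough_pair U R (U \<inter> \<Inter>(fst ` F), U \<inter> \<Inter>(snd ` F))"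
proof -
  have sub: "fst p \<subseteq> snd p" if "p \<in> F" for p
    using pair[OF that] by (auto simp: rough_pair_def)
  have up: "nbhd U R x \<subseteq> fst p" if "p \<in> F" "x \<in> fst p" for p x
    using pair[OF that(1)] that(2) by (auto simp: rough_pair_def)
  have down: "x \<in> snd p" if "p \<in> F" "x \<in> U" "nbhd U R x \<inter> snd p \<noteq> {}" for p x
    using pair[OF that(1)] that(2,3) by (auto simp: rough_pair_def)
  have isolated: "nbhd U R x \<noteq> {x}" if "p \<in> F" "x \<in> snd p" "x \<notin> fst p" for p x
    using pair[OF that(1)] that(2,3) by (auto simp: rough_pair_def)
  show ?thesis
    unfolding rough_pair_def fst_conv snd_conv
  proof (intro conjI ballI impI)
    show "U \<inter> \<Inter>(fst ` F) \<subseteq> U \<inter> \<Inter>(snd ` F)" "U \<inter> \<Inter>(snd ` F) \<subseteq> U"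
      using sub by blast+
    show "nbhd U R x \<subseteq> U \<inter> \<Inter>(fst ` F)" if "x \<in> U \<inter> \<Inter>(fst ` F)" for x
    proof -
      have "nbhd U R x \<subseteq> U" by (auto simp: nbhd_def)
      then show ?thesis using that up by blast
    qed
    show "x \<in> U \<inter> \<Inter>(snd ` F)" if "x \<in> U" "nbhd U R x \<inter> (U \<inter> \<Inter>(snd ` F)) \<noteq> {}" for x
      using that down by blast
    show "nbhd U R x \<noteq> {x}" if "x \<in> U \<inter> \<Inter>(snd ` F) - U \<inter> \<Inter>(fst ` F)" for x
      using that isolated by blast
  qed
qed

theorem theorem3p2:
  fixes U :: "'a set" and R :: "'a rel"
  assumes "U \<noteq> {}"
    and "preorder_on U R"
  shows "complete_sublattice (RS_order U R) (Pow_prod U)"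
proof -
  have RS_Pow: "RS U R \<subseteq> Pow U \<times> Pow U"
    by (auto simp: RS_def rough_set_def lower_approx_def upper_approx_def)
  have "\<Squnion>\<^bsub>Pow_prod U\<^esub>F \<in> RS U R \<and> \<Sqinter>\<^bsub>Pow_prod U\<^esub>F \<in> RS U R" if F: "F \<subseteq> RS U R" for F
  proof -
    have "rough_pair U R p" if "p \<in> F" for p
      using F that RS_iff_rough_pair[OF assms(2)] by blast
    then show ?thesis
      using F RS_Pow rough_pair_Union[of F U R] rough_pair_Inter[of F U R]
      by (simp add: sup_Pow_prod inf_Pow_prod RS_iff_rough_pair[OF assms(2)])
  qed
  then show ?thesis
    using complete_lattice_Pow_prod RS_Pow
    by (simp add: complete_sublattice_def RS_order_def)
qed

end
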